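(* Let $A$ be a hyper-C*-algebra with respect to $n$ pairs of product/involution $(\cdot_k,\dagger_k)$, $k=0,\dots,n-1$. Let $(X,\circ_0,\dots,\circ_{n-1},*_0,\dots,*_{n-1})$ be a fully involutive strict globular $n$-category (with usual or with non-commutative exchange). Then the convolution $n$-bundle $E=X\times A$, with the operations $$a_x\circ_k b_y:=(a\cdot_k b)_{x\circ_k y}\ \text{(defined whenever } x\circ_k y \text{ exists)},\qquad (a_x)^{*_k}:=(a^{\dagger_k})_{x^{*_k}},\qquad k=0,\dots,n-1,$$ is a fully involutive globular $n$-category, necessarily with non-commutative exchange (rather than the usual exchange) as soon as one of the products in $A$ is non-commutative.
   Context: A 1-category (arrows-only form) $(C,\circ)$ is a class $C$ with a partially defined binary operation $\circ$ such that: if one of $f\circ(g\circ h)$, $(f\circ g)\circ h$ exists so does the other and they are equal; for every $f$ there are a right-composable $r$ and a left-composable $l$ that are partial identities (an element $e$ is a partial identity if $h\circ e=h$ and $e\circ h=h$ whenever these compositions exist); if some right identity of $f$ is also a left identity of $g$, then $f\circ g$ exists. A (strict globular) $n$-category $(C,\circ_0,\dots,\circ_{n-1})$ is a class with $n$ partial binary operations such that: each $(C,\circ_p)$ is a 1-category, with class of partial identities denoted $C^p$ (and $C^n:=C$); $C^q\subset C^p$ for $q<p$; for $q<p$ the $\circ_q$-composition of $\circ_p$-identities, whenever it exists, is a $\circ_p$-identity; and one of the following exchange properties holds. Usual exchange: for all $q<p$, whenever $(x\circ_p y)\circ_q(w\circ_p z)$ exists, also $(x\circ_q w)\circ_p(y\circ_q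 z)$ exists and they coincide. Non-commutative exchange: for every $\circ_p$-identity $\iota$ and every $q<p$, the partially defined maps $\iota\circ_q-$ and $-\circ_q\iota$ preserve existing $\circ_p$-compositions and $\circ_p$-identities. An $n$-category is fully involutive if it has, for each $q=0,\dots,n-1$, a map $*_q:C\to C$ with: $(x^{*_q})^{*_q}=x$; if $x\circ_p y$ exists, then for $p\ne q$ $x^{*_q}\circ_p y^{*_q}$ exists and equals $(x\circ_p y)^{*_q}$, and for $p=q$ $y^{*_q}\circ_q x^{*_q}$ exists and equals $(x\circ_q y)^{*_q}$; $*_q$ sends $\circ_p$-identities to $\circ_p$-identities for all $p$; and $(x^{*_q})^{*_p}=(x^{*_p})^{*_q}$. A hyper-C*-algebra is a complete topological complex vector space $A$ equipped with pairs of multiplication/involution $(\cdot_k,\dagger_k)$, $k=0,\dots,n-1$, each inducing on $A$ the structure of a (unital) C*-algebra, via a (necessarily unique) C*-norm $\|\cdot\|_k$, compatible with the given topology. Elements of $E=X\times A$ are written $a_x:=(a,x)$; $E$ embeds in the space $\mathbb{M}_X(A)$ of sections (functions $X\to A$).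
   Formalization: Assumes in addition that all products ·_k share one unit, that †_q is multiplicative for ·_p (p≠q), and that the †_k commute (the claim fails otherwise for non-empty X); failure of the usual exchange is claimed only for X non-empty and n≥2. *)

theory Defs
  imports "HOL-Analysis.Analysis"
begin

section \<open>Strict globular n-categories, arrows-only form\<close>

text \<open>
  A class with a partial binary operation is a carrier set \<open>C\<close> together with
  \<open>cmp :: 'x \<Rightarrow> 'x \<Rightarrow> 'x option\<close>; the value \<open>None\<close> means that the composition
  does not exist.
\<close>

definition partial_identities :: "'x set \<Rightarrow> ('x \<Rightarrow> 'x \<Rightarrow> 'x option) \<Rightarrow> 'x set" where
  "partial_identities C cmp =
     {e \<in> C. \<forall>h\<in>C. (cmp h e \<noteq> None \<longrightarrow> cmp h e = Some h) \<and>
                   (cmp e h \<noteq> None \<longrightarrow> cmp e h = Some h)}"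

locale one_category =
  fixes C :: "'x set" and cmp :: "'x \<Rightarrow> 'x \<Rightarrow> 'x option"
  assumes closed: "\<lbrakk>f \<in> C; g \<in> C; cmp f g = Some h\<rbrakk> \<Longrightarrow> h \<in> C"
    (* equality of options: both sides are undefined, or both are defined and equal *)
    and assoc: "\<lbrakk>f \<in> C; g \<in> C; h \<in> C\<rbrakk> \<Longrightarrow>
      Option.bind (cmp g h) (\<lambda>u. cmp f u) = Option.bind (cmp f g) (\<lambda>v. cmp v h)"
    and right_identity: "f \<in> C \<Longrightarrow> \<exists>r \<in> partial_identities C cmp. cmp f r \<noteq> None"
    and left_identity: "f \<in> C \<Longrightarrow> \<exists>l \<in> partial_identities C cmp. cmp l f \<noteq> None"
    and composable: "\<lbrakk>f \<in> C; g \<in> C; e \<in> partial_identities C cmp;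
      cmp f e \<noteq> None; cmp e g \<noteq> None\<rbrakk> \<Longrightarrow> cmp f g \<noteq> None"

definition usual_exchange :: "nat \<Rightarrow> 'x set \<Rightarrow> (nat \<Rightarrow> 'x \<Rightarrow> 'x \<Rightarrow> 'x option) \<Rightarrow> bool" where
  "usual_exchange n C cmp \<longleftrightarrow>
     (\<forall>p q x y w z u v t. q < p \<and> p < n \<and> x \<in> C \<and> y \<in> C \<and> w \<in> C \<and> z \<in> C \<and>
        cmp p x y = Some u \<and> cmp p w z = Some v \<and> cmp q u v = Some t \<longrightarrow>
        (\<exists>r s. cmp q x w = Some r \<and> cmp q y z = Some s \<and> cmp p r s = Some t))"

text \<open>
  A partially defined map \<open>F\<close> preserves the existing compositions when, for \<open>y\<close>, \<open>z\<close>
  such that \<open>y \<circ> z\<close> exists and lies in the domain of \<open>F\<close>, also \<open>F y\<close>, \<open>F z\<close> and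
  \<open>F y \<circ> F z\<close> exist and \<open>F (y \<circ> z) = F y \<circ> F z\<close>.
\<close>

definition preserves_compositions ::
  "'x set \<Rightarrow> ('x \<Rightarrow> 'x \<Rightarrow> 'x option) \<Rightarrow> ('x \<Rightarrow> 'x option) \<Rightarrow> bool" where
  "preserves_compositions C cmp F \<longleftrightarrow>
     (\<forall>y z u t. y \<in> C \<and> z \<in> C \<and> cmp y z = Some u \<and> F u = Some t \<longrightarrow>
        (\<exists>r s. F y = Some r \<and> F z = Some s \<and> cmp r s = Some t))"

definition preserves_identities ::
  "'x set \<Rightarrow> ('x \<Rightarrow> 'x \<Rightarrow> 'x option) \<Rightarrow> ('x \<Rightarrow> 'x option) \<Rightarrow> bool" where
  "preserves_identities C cmp F \<longleftrightarrow>
     (\<forall>e t. e \<in> partial_identities C cmp \<and> F e = Some t \<longrightarrow> t \<in> partial_identities C cmp)"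

definition noncommutative_exchange ::
  "nat \<Rightarrow> 'x set \<Rightarrow> (nat \<Rightarrow> 'x \<Rightarrow> 'x \<Rightarrow> 'x option) \<Rightarrow> bool" where
  "noncommutative_exchange n C cmp \<longleftrightarrow>
     (\<forall>p q i. q < p \<and> p < n \<and> i \<in> partial_identities C (cmp p) \<longrightarrow>
        preserves_compositions C (cmp p) (\<lambda>x. cmp q i x) \<and>
        preserves_identities C (cmp p) (\<lambda>x. cmp q i x) \<and>
        preserves_compositions C (cmp p) (\<lambda>x. cmp q x i) \<and>
        preserves_identities C (cmp p) (\<lambda>x. cmp q x i))"

locale n_category =
  fixes n :: nat and C :: "'x set" and cmp :: "nat \<Rightarrow> 'x \<Rightarrow> 'x \<Rightarrow> 'x option"
  assumes one_category: "p < n \<Longrightarrow> one_category C (cmp p)"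
    and identities_mono: "\<lbrakk>q < p; p < n\<rbrakk> \<Longrightarrow>
      partial_identities C (cmp q) \<subseteq> partial_identities C (cmp p)"
    and identities_comp: "\<lbrakk>q < p; p < n; e \<in> partial_identities C (cmp p);
      e' \<in> partial_identities C (cmp p); cmp q e e' = Some t\<rbrakk> \<Longrightarrow>
      t \<in> partial_identities C (cmp p)"
    and exchange: "usual_exchange n C cmp \<or> noncommutative_exchange n C cmp"

locale fully_involutive_n_category = n_category n C cmp
  for n :: nat and C :: "'x set" and cmp :: "nat \<Rightarrow> 'x \<Rightarrow> 'x \<Rightarrow> 'x option" +
  fixes dag :: "nat \<Rightarrow> 'x \<Rightarrow> 'x"
  assumes dag_closed: "\<lbrakk>q < n; x \<in> C\<rbrakk> \<Longrightarrow> dag q x \<in> C"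
    and dag_dag: "\<lbrakk>q < n; x \<in> C\<rbrakk> \<Longrightarrow> dag q (dag q x) = x"
    and dag_comp_neq: "\<lbrakk>p < n; q < n; p \<noteq> q; x \<in> C; y \<in> C; cmp p x y = Some z\<rbrakk> \<Longrightarrow>
      cmp p (dag q x) (dag q y) = Some (dag q z)"
    and dag_comp_eq: "\<lbrakk>q < n; x \<in> C; y \<in> C; cmp q x y = Some z\<rbrakk> \<Longrightarrow>
      cmp q (dag q y) (dag q x) = Some (dag q z)"
    and dag_identities: "\<lbrakk>p < n; q < n; e \<in> partial_identities C (cmp p)\<rbrakk> \<Longrightarrow>
      dag q e \<in> partial_identities C (cmp p)"
    and dag_commute: "\<lbrakk>p < n; q < n; x \<in> C\<rbrakk> \<Longrightarrow> dag p (dag q x) = dag q (dag p x)"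

section \<open>Hyper-C*-algebras\<close>

text \<open>
  Complex scalar multiplication is an explicit argument, since the libraries
  have no type class of complex vector spaces. Completeness is meant for the
  uniformity of the additive topological group.
\<close>

locale complete_topological_vector_space = vector_space smul
  for smul :: "complex \<Rightarrow> 'a::topological_ab_group_add \<Rightarrow> 'a" +
  assumes continuous_scale: "continuous_on UNIV (\<lambda>(c, a). smul c a)"
    and cauchy_filters_converge: "\<lbrakk>(F :: 'a filter) \<noteq> bot;
      \<And>U. \<lbrakk>open U; 0 \<in> U\<rbrakk> \<Longrightarrow> eventually (\<lambda>(a, b). a - b \<in> U) (F \<times>\<^sub>F F)\<rbrakk> \<Longrightarrow>
      \<exists>l. F \<le> nhds l"

locale cstar_algebra = vector_space smul
  for smul :: "complex \<Rightarrow> 'a::ab_group_add \<Rightarrow> 'a" +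
  fixes prd :: "'a \<Rightarrow> 'a \<Rightarrow> 'a" and one :: 'a and star :: "'a \<Rightarrow> 'a" and nrm :: "'a \<Rightarrow> real"
  assumes mult_assoc: "prd (prd a b) c = prd a (prd b c)"
    and mult_add_left: "prd (a + b) c = prd a c + prd b c"
    and mult_add_right: "prd a (b + c) = prd a b + prd a c"
    and mult_scale_left: "prd (smul s a) b = smul s (prd a b)"
    and mult_scale_right: "prd a (smul s b) = smul s (prd a b)"
    and mult_one_left: "prd one a = a"
    and mult_one_right: "prd a one = a"
    and star_star: "star (star a) = a"
    and star_add: "star (a + b) = star a + star b"
    and star_scale: "star (smul s a) = smul (cnj s) (star a)"
    and star_mult: "star (prd a b) = prd (star b) (star a)"
    and nrm_eq_0: "nrm a = 0 \<longleftrightarrow> a = 0"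
    and nrm_triangle: "nrm (a + b) \<le> nrm a + nrm b"
    and nrm_scale: "nrm (smul s a) = cmod s * nrm a"
    and nrm_mult: "nrm (prd a b) \<le> nrm a * nrm b"
    and cstar_identity: "nrm (prd (star a) a) = (nrm a)\<^sup>2"
    and nrm_complete: "(\<forall>e>0. \<exists>M. \<forall>i\<ge>M. \<forall>j\<ge>M. nrm (f i - f j) < e) \<Longrightarrow>
      \<exists>l. (\<lambda>i::nat. nrm (f i - l)) \<longlonglongrightarrow> 0"

definition norm_induces_topology :: "('a::topological_ab_group_add \<Rightarrow> real) \<Rightarrow> bool" where
  "norm_induces_topology nrm \<longleftrightarrow>
     (\<forall>S. open S \<longleftrightarrow> (\<forall>a\<in>S. \<exists>e>0. \<forall>b. nrm (b - a) < e \<longrightarrow> b \<in> S))"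

locale hyper_cstar_algebra = complete_topological_vector_space smul
  for smul :: "complex \<Rightarrow> 'a::topological_ab_group_add \<Rightarrow> 'a" +
  fixes n :: nat and prd :: "nat \<Rightarrow> 'a \<Rightarrow> 'a \<Rightarrow> 'a" and one :: "nat \<Rightarrow> 'a"
    and star :: "nat \<Rightarrow> 'a \<Rightarrow> 'a"
  assumes cstar: "k < n \<Longrightarrow>
    \<exists>nrm. cstar_algebra smul (prd k) (one k) (star k) nrm \<and> norm_induces_topology nrm"

text \<open>
  A hyper-C*-algebra relates its different products and involutions only through the
  common topology: the units may differ, the involutions need not commute, and one
  involution need not be multiplicative for another product.
  The following predicate collects these compatibilities; the lemma
  \<open>compatible_pairs_necessary\<close> below shows that the convolution bundle
  over a non-empty category cannot be a fully involutive n-category without them.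
\<close>

definition compatible_pairs ::
  "nat \<Rightarrow> (nat \<Rightarrow> 'a \<Rightarrow> 'a \<Rightarrow> 'a) \<Rightarrow> (nat \<Rightarrow> 'a) \<Rightarrow> (nat \<Rightarrow> 'a \<Rightarrow> 'a) \<Rightarrow> bool" where
  "compatible_pairs n prd one star \<longleftrightarrow>
     (\<forall>p<n. \<forall>q<n. one p = one q) \<and>
     (\<forall>p<n. \<forall>q<n. p \<noteq> q \<longrightarrow>
        (\<forall>a b. star q (prd p a b) = prd p (star q a) (star q b))) \<and>
     (\<forall>p<n. \<forall>q<n. \<forall>a. star p (star q a) = star q (star p a))"

section \<open>The convolution bundle\<close>

text \<open>The element \<open>a\<^sub>x\<close> of \<open>E = X \<times> A\<close> is the pair \<open>(x, a)\<close>; the algebra is a whole type.\<close>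

definition conv_bundle :: "'x set \<Rightarrow> ('x \<times> 'a) set" where
  "conv_bundle X = X \<times> UNIV"

definition conv_bundle_comp :: "(nat \<Rightarrow> 'x \<Rightarrow> 'x \<Rightarrow> 'x option) \<Rightarrow> (nat \<Rightarrow> 'a \<Rightarrow> 'a \<Rightarrow> 'a) \<Rightarrow>
    nat \<Rightarrow> 'x \<times> 'a \<Rightarrow> 'x \<times> 'a \<Rightarrow> ('x \<times> 'a) option" where
  "conv_bundle_comp cmp prd k e f =
     map_option (\<lambda>z. (z, prd k (snd e) (snd f))) (cmp k (fst e) (fst f))"

definition conv_bundle_inv :: "(nat \<Rightarrow> 'x \<Rightarrow> 'x) \<Rightarrow> (nat \<Rightarrow> 'a \<Rightarrow> 'a) \<Rightarrow>
    nat \<Rightarrow> 'x \<times> 'a \<Rightarrow> 'x \<times> 'a" where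
  "conv_bundle_inv dag star k e = (dag k (fst e), star k (snd e))"

lemma partial_identities_conv_bundle:
  assumes hyper: "hyper_cstar_algebra smul n prd one star"
    and one_cat: "one_category X (cmp k)" and k: "k < n"
  shows "partial_identities (conv_bundle X) (conv_bundle_comp cmp prd k) =
    partial_identities X (cmp k) \<times> {one k}"
proof -
  obtain nrm where "cstar_algebra smul (prd k) (one k) (star k) nrm"
    using hyper_cstar_algebra.cstar[OF hyper k] by blast
  then interpret A: cstar_algebra smul "prd k" "one k" "star k" nrm .
  interpret X: one_category X "cmp k" by (rule one_cat)
  show ?thesis
  proof (intro set_eqI iffI)
    fix e assume e: "e \<in> partial_identities (conv_bundle X) (conv_bundle_comp cmp prd k)"
    obtain i u where [simp]: "e = (i, u)" by (cases e)
    have iX: "i \<in> X" using e by (auto simp: partial_identities_def conv_bundle_def)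
    have right: "cmp k h i = Some z \<Longrightarrow> h \<in> X \<Longrightarrow> z = h \<and> prd k a u = a" for h z a
      using e unfolding partial_identities_def
      by (force simp: conv_bundle_def conv_bundle_comp_def)
    have left: "cmp k i h = Some z \<Longrightarrow> h \<in> X \<Longrightarrow> z = h \<and> prd k u a = a" for h z a
      using e unfolding partial_identities_def
      by (force simp: conv_bundle_def conv_bundle_comp_def)
    have "i \<in> partial_identities X (cmp k)"
      using iX left right by (auto simp: partial_identities_def)
    moreover obtain l z where "l \<in> X" "cmp k l i = Some z"
      using X.left_identity[OF iX] by (auto simp: partial_identities_def)
    then have "u = one k" using right[of l z "one k"] A.mult_one_left[of u] by simp
    ultimately show "e \<in> partial_identities X (cmp k) \<times> {one k}" by simp
  next
    fix e assume "e \<in> partial_identities X (cmp k) \<times> {one k}"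
    then show "e \<in> partial_identities (conv_bundle X) (conv_bundle_comp cmp prd k)"
      by (auto simp: partial_identities_def conv_bundle_def conv_bundle_comp_def
            A.mult_one_left A.mult_one_right)
  qed
qed

lemma compatible_pairs_necessary:
  assumes hyper: "hyper_cstar_algebra smul n prd one star"
    and category: "fully_involutive_n_category n X cmp dag"
    and convolution: "fully_involutive_n_category n (conv_bundle X)
      (conv_bundle_comp cmp prd) (conv_bundle_inv dag star)"
    and nonempty: "X \<noteq> {}"
  shows "compatible_pairs n prd one star"
proof -
  interpret X: fully_involutive_n_category n X cmp dag by (rule category)
  interpret E: fully_involutive_n_category n "conv_bundle X"
    "conv_bundle_comp cmp prd" "conv_bundle_inv dag star" by (rule convolution)
  obtain x where x: "x \<in> X" using nonempty by blast
  have units: "one q = one p" if "q < p" "p < n" for p q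
  proof -
    have q: "q < n" using that by simp
    obtain e where e: "e \<in> partial_identities X (cmp q)"
      using one_category.right_identity[OF X.one_category[OF q] x] by blast
    then show ?thesis
      using E.identities_mono[OF that] that q
      by (auto simp: partial_identities_conv_bundle[OF hyper X.one_category])
  qed
  have hom: "star q (prd p a b) = prd p (star q a) (star q b)"
    if "p < n" "q < n" "p \<noteq> q" for p q a b
  proof -
    obtain r where "r \<in> X" "cmp p x r \<noteq> None"
      using one_category.right_identity[OF X.one_category[OF \<open>p < n\<close>] x]
      unfolding partial_identities_def by blast
    then show ?thesis
      using E.dag_comp_neq[OF that, of "(x, a)" "(r, b)"] x
      by (auto simp: conv_bundle_def conv_bundle_comp_def conv_bundle_inv_def)
  qed
  have "star p (star q a) = star q (star p a)" if "p < n" "q < n" for p q a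
    using E.dag_commute[OF that, of "(x, a)"] x
    by (auto simp: conv_bundle_def conv_bundle_inv_def)
  moreover have "one p = one q" if "p < n" "q < n" for p q
    using units that by (metis linorder_neqE_nat)
  ultimately show ?thesis unfolding compatible_pairs_def using hom by blast
qed

end

theory Submission
  imports Defs
begin

text \<open>
  Every operation on \<open>X \<times> A\<close> acts separately on the two factors, and whether a composite
  exists depends only on the base points. An equational axiom therefore splits into the same
  axiom for \<open>X\<close> and an identity for the products and involutions of \<open>A\<close>. The partial
  identities of \<open>\<circ>\<^sub>p\<close> are the pairs of a partial identity of \<open>X\<close> and the unit of \<open>\<cdot>\<^sub>p\<close>
  (lemma \<open>partial_identities_conv_bundle\<close>); since all products have the same unit, the identities for \<open>\<circ>\<^sub>q\<close> are identities for \<open>\<circ>\<^sub>p\<close> when \<open>q < p\<close>.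

  The usual exchange does not pass from \<open>X\<close> to the bundle: on the algebra factor it would demand
  \<open>(a \<cdot>\<^sub>p b) \<cdot>\<^sub>q (c \<cdot>\<^sub>p d) = (a \<cdot>\<^sub>q c) \<cdot>\<^sub>p (b \<cdot>\<^sub>q d)\<close>, and since the two products share
  their unit, the Eckmann--Hilton argument (lemma \<open>Eckmann_Hilton_commute\<close>) makes both of them
  commutative. To realise this identity inside the bundle it suffices to stay in the fibre over a
  single partial identity \<open>e\<close> of \<open>\<circ>\<^sub>q\<close>, which composes with itself for both compositions.
  The non-commutative exchange only involves \<open>\<circ>\<^sub>q\<close>-composition with pairs whose algebra
  component is the common unit, so on the algebra factor it follows from the unit laws.
  On the base it always holds: a partial identity satisfies \<open>\<iota> \<circ>\<^sub>p \<iota> = \<iota>\<close>, hence the usual exchange for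
  \<open>(\<iota> \<circ>\<^sub>p \<iota>) \<circ>\<^sub>q (y \<circ>\<^sub>p z)\<close> is already the non-commutative one
  (lemma \<open>usual_imp_noncommutative_exchange\<close>).
\<close>

section \<open>Partial identities and exchange\<close>

lemma partial_identities_subset: "partial_identities C cmp \<subseteq> C"
  by (auto simp: partial_identities_def)

text \<open>
  A right identity \<open>r\<close> that composes with \<open>e\<close> equals \<open>e\<close>, since \<open>e \<circ> r\<close> can be
  evaluated by either of the two identities.
\<close>

lemma (in one_category) partial_identity_idem:
  assumes "e \<in> partial_identities C cmp"
  shows "cmp e e = Some e"
proof -
  have "e \<in> C" using assms by (simp add: partial_identities_def)
  then obtain r where "r \<in> partial_identities C cmp" and r: "cmp e r \<noteq> None"
    using right_identity by blast
  then have "cmp e r = Some e" and "cmp e r = Some r"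
    using assms \<open>e \<in> C\<close> by (simp_all add: partial_identities_def)
  then show ?thesis by simp
qed

text \<open>
  Writing a \<open>\<circ>\<^sub>p\<close>-identity \<open>i\<close> as \<open>i \<circ>\<^sub>p i\<close> makes whiskering by \<open>i\<close> an instance
  of the usual exchange.
\<close>

lemma (in n_category) usual_imp_noncommutative_exchange:
  assumes usual: "usual_exchange n C cmp"
  shows "noncommutative_exchange n C cmp"
  unfolding noncommutative_exchange_def
proof (intro allI impI, elim conjE)
  fix p q i assume "q < p" "p < n" and i: "i \<in> partial_identities C (cmp p)"
  interpret P: one_category C "cmp p" using one_category[OF \<open>p < n\<close>] .
  have ii: "cmp p i i = Some i" by (rule P.partial_identity_idem[OF i])
  have iC: "i \<in> C" using i partial_identities_subset by fast
  have exch: "\<exists>r s. cmp q x w = Some r \<and> cmp q y z = Some s \<and> cmp p r s = Some t"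
    if "x \<in> C" "y \<in> C" "w \<in> C" "z \<in> C"
      "cmp p x y = Some u" "cmp p w z = Some v" "cmp q u v = Some t" for x y w z u v t
    using usual that \<open>q < p\<close> \<open>p < n\<close> unfolding usual_exchange_def by blast
  have "preserves_compositions C (cmp p) (\<lambda>x. cmp q i x)"
    unfolding preserves_compositions_def using exch[OF iC iC _ _ ii] by blast
  moreover have "preserves_compositions C (cmp p) (\<lambda>x. cmp q x i)"
    unfolding preserves_compositions_def using exch[OF _ _ iC iC _ ii] by blast
  moreover have "preserves_identities C (cmp p) (\<lambda>x. cmp q i x)"
    "preserves_identities C (cmp p) (\<lambda>x. cmp q x i)"
    unfolding preserves_identities_def using identities_comp[OF \<open>q < p\<close> \<open>p < n\<close>] i by blast+
  ultimately show "preserves_compositions C (cmp p) (\<lambda>x. cmp q i x) \<and>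
      preserves_identities C (cmp p) (\<lambda>x. cmp q i x) \<and>
      preserves_compositions C (cmp p) (\<lambda>x. cmp q x i) \<and>
      preserves_identities C (cmp p) (\<lambda>x. cmp q x i)"
    by blast
qed

lemma (in n_category) noncommutative_exchange: "noncommutative_exchange n C cmp"
  using exchange usual_imp_noncommutative_exchange by blast

section \<open>Units and commutativity of products\<close>

lemma (in cstar_algebra) star_one: "star one = one"
proof -
  have "star (prd (star one) one) = prd (star one) one" by (simp only: star_mult star_star)
  then show ?thesis by (simp only: mult_one_right star_star)
qed

lemma hyper_cstar_algebra_cstarE:
  assumes "hyper_cstar_algebra smul n prd one star" "k < n"
  obtains nrm where "cstar_algebra smul (prd k) (one k) (star k) nrm"
  using hyper_cstar_algebra.cstar[OF assms] by blast

text \<open>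
  Exchange for \<open>(1, b, a, 1)\<close> and for \<open>(a, 1, 1, b)\<close> shows that \<open>g\<close> is the opposite
  of \<open>f\<close> and that it is \<open>f\<close> itself.
\<close>

lemma Eckmann_Hilton_commute:
  assumes exch: "\<And>a b c d. g (f a b) (f c d) = f (g a c) (g b d)"
    and unit_f: "\<And>a. f u a = a" "\<And>a. f a u = a"
    and unit_g: "\<And>a. g u a = a" "\<And>a. g a u = a"
  shows "f a b = f b a" and "g a b = g b a"
proof -
  have opp: "g b a = f a b" for a b using exch[of u b a u] by (simp add: unit_f unit_g)
  have same: "g a b = f a b" for a b using exch[of a u u b] by (simp add: unit_f unit_g)
  show "f a b = f b a" by (rule trans[OF same[symmetric] opp])
  show "g a b = g b a" by (rule trans[OF same opp[symmetric]])
qed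

section \<open>The convolution bundle\<close>

lemma conv_bundle_comp_eq_Some_iff:
  "conv_bundle_comp cmp prd k e f = Some g \<longleftrightarrow>
     cmp k (fst e) (fst f) = Some (fst g) \<and> snd g = prd k (snd e) (snd f)"
  by (cases g) (auto simp: conv_bundle_comp_def)

lemma conv_bundle_comp_eq_None_iff:
  "conv_bundle_comp cmp prd k e f = None \<longleftrightarrow> cmp k (fst e) (fst f) = None"
  by (simp add: conv_bundle_comp_def)

lemma mem_conv_bundle_iff: "e \<in> conv_bundle X \<longleftrightarrow> fst e \<in> X"
  by (cases e) (simp add: conv_bundle_def)

lemma one_category_conv_bundle:
  fixes X :: "'x set" and prd :: "nat \<Rightarrow> 'a \<Rightarrow> 'a \<Rightarrow> 'a::topological_ab_group_add"
  assumes hyper: "hyper_cstar_algebra smul n prd one star"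
    and X: "one_category X (cmp k)" and k: "k < n"
  shows "one_category (conv_bundle X) (conv_bundle_comp cmp prd k)"
proof -
  obtain nrm where "cstar_algebra smul (prd k) (one k) (star k) nrm"
    using hyper_cstar_algebra_cstarE[OF hyper k] .
  then interpret A: cstar_algebra smul "prd k" "one k" "star k" nrm .
  interpret X: one_category X "cmp k" by (rule X)
  note ids = partial_identities_conv_bundle[where cmp = cmp and k = k, OF hyper X k]
  show ?thesis
  proof
    fix f g h :: "'x \<times> 'a"
    assume "f \<in> conv_bundle X" "g \<in> conv_bundle X" "conv_bundle_comp cmp prd k f g = Some h"
    then show "h \<in> conv_bundle X"
      using X.closed[of "fst f" "fst g" "fst h"]
      by (simp add: mem_conv_bundle_iff conv_bundle_comp_eq_Some_iff)
  next
    fix f g h :: "'x \<times> 'a"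
    assume "f \<in> conv_bundle X" "g \<in> conv_bundle X" "h \<in> conv_bundle X"
    then have "Option.bind (cmp k (fst g) (fst h)) (\<lambda>u. cmp k (fst f) u) =
        Option.bind (cmp k (fst f) (fst g)) (\<lambda>v. cmp k v (fst h))"
      by (intro X.assoc) (simp_all add: mem_conv_bundle_iff)
    then show "Option.bind (conv_bundle_comp cmp prd k g h) (\<lambda>u. conv_bundle_comp cmp prd k f u) =
        Option.bind (conv_bundle_comp cmp prd k f g) (\<lambda>v. conv_bundle_comp cmp prd k v h)"
      by (cases "cmp k (fst g) (fst h)"; cases "cmp k (fst f) (fst g)")
        (auto simp: conv_bundle_comp_def A.mult_assoc)
  next
    fix f :: "'x \<times> 'a" assume "f \<in> conv_bundle X"
    then have fX: "fst f \<in> X" by (simp add: mem_conv_bundle_iff)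
    show "\<exists>r \<in> partial_identities (conv_bundle X) (conv_bundle_comp cmp prd k).
        conv_bundle_comp cmp prd k f r \<noteq> None"
      using X.right_identity[OF fX] by (auto simp: ids conv_bundle_comp_def)
    show "\<exists>l \<in> partial_identities (conv_bundle X) (conv_bundle_comp cmp prd k).
        conv_bundle_comp cmp prd k l f \<noteq> None"
      using X.left_identity[OF fX] by (auto simp: ids conv_bundle_comp_def)
  next
    fix f g e :: "'x \<times> 'a"
    assume "f \<in> conv_bundle X" "g \<in> conv_bundle X"
      and "e \<in> partial_identities (conv_bundle X) (conv_bundle_comp cmp prd k)"
      and "conv_bundle_comp cmp prd k f e \<noteq> None" "conv_bundle_comp cmp prd k e g \<noteq> None"
    then show "conv_bundle_comp cmp prd k f g \<noteq> None"
      using X.composable[of "fst f" "fst g" "fst e"]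
      by (auto simp: ids mem_conv_bundle_iff conv_bundle_comp_eq_None_iff)
  qed
qed

text \<open>
  A \<open>\<circ>\<^sub>p\<close>-identity of the bundle has algebra component \<open>1\<^sub>p = 1\<^sub>q\<close>, so composing with it
  for \<open>\<circ>\<^sub>q\<close> changes only the base point, and the exchange reduces to that of \<open>X\<close>.
\<close>

lemma noncommutative_exchange_conv_bundle:
  assumes hyper: "hyper_cstar_algebra smul n prd one star"
    and units: "\<And>p q. p < n \<Longrightarrow> q < n \<Longrightarrow> one p = one q"
    and X: "n_category n X cmp"
  shows "noncommutative_exchange n (conv_bundle X) (conv_bundle_comp cmp prd)"
  unfolding noncommutative_exchange_def
proof (intro allI impI, elim conjE)
  fix p q e
  assume "q < p" "p < n"
    and e: "e \<in> partial_identities (conv_bundle X) (conv_bundle_comp cmp prd p)"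
  then have "q < n" by simp
  interpret X: n_category n X cmp by (rule X)
  obtain nrm where "cstar_algebra smul (prd q) (one q) (star q) nrm"
    using hyper_cstar_algebra_cstarE[OF hyper \<open>q < n\<close>] .
  then interpret Q: cstar_algebra smul "prd q" "one q" "star q" nrm .
  note ids = partial_identities_conv_bundle
      [where cmp = cmp and k = p, OF hyper X.one_category[OF \<open>p < n\<close>] \<open>p < n\<close>]
  have "one p = one q" using units \<open>p < n\<close> \<open>q < n\<close> by blast
  then obtain i where e_eq: "e = (i, one q)" and i: "i \<in> partial_identities X (cmp p)"
    using e by (auto simp: ids)
  have X_exch: "preserves_compositions X (cmp p) (cmp q i)"
      "preserves_identities X (cmp p) (cmp q i)"
      "preserves_compositions X (cmp p) (\<lambda>x. cmp q x i)"
      "preserves_identities X (cmp p) (\<lambda>x. cmp q x i)"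
    using X.noncommutative_exchange \<open>q < p\<close> \<open>p < n\<close> i
    unfolding noncommutative_exchange_def by blast+
  have left: "\<exists>r s. conv_bundle_comp cmp prd q e y = Some r \<and>
      conv_bundle_comp cmp prd q e z = Some s \<and> conv_bundle_comp cmp prd p r s = Some t"
    if "y \<in> conv_bundle X" "z \<in> conv_bundle X" "conv_bundle_comp cmp prd p y z = Some u"
      "conv_bundle_comp cmp prd q e u = Some t" for y z u t
  proof -
    have base: "fst y \<in> X" "fst z \<in> X" "cmp p (fst y) (fst z) = Some (fst u)"
        "cmp q i (fst u) = Some (fst t)"
      using that by (simp_all add: mem_conv_bundle_iff conv_bundle_comp_eq_Some_iff e_eq)
    obtain r s where "cmp q i (fst y) = Some r" "cmp q i (fst z) = Some s"
        "cmp p r s = Some (fst t)"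
      using X_exch(1) base unfolding preserves_compositions_def by blast
    then show ?thesis
      using that by (intro exI[of _ "(r, snd y)"] exI[of _ "(s, snd z)"])
        (simp add: conv_bundle_comp_eq_Some_iff e_eq Q.mult_one_left)
  qed
  have right: "\<exists>r s. conv_bundle_comp cmp prd q y e = Some r \<and>
      conv_bundle_comp cmp prd q z e = Some s \<and> conv_bundle_comp cmp prd p r s = Some t"
    if "y \<in> conv_bundle X" "z \<in> conv_bundle X" "conv_bundle_comp cmp prd p y z = Some u"
      "conv_bundle_comp cmp prd q u e = Some t" for y z u t
  proof -
    have base: "fst y \<in> X" "fst z \<in> X" "cmp p (fst y) (fst z) = Some (fst u)"
        "cmp q (fst u) i = Some (fst t)"
      using that by (simp_all add: mem_conv_bundle_iff conv_bundle_comp_eq_Some_iff e_eq)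
    obtain r s where "cmp q (fst y) i = Some r" "cmp q (fst z) i = Some s"
        "cmp p r s = Some (fst t)"
      using X_exch(3) base unfolding preserves_compositions_def by blast
    then show ?thesis
      using that by (intro exI[of _ "(r, snd y)"] exI[of _ "(s, snd z)"])
        (simp add: conv_bundle_comp_eq_Some_iff e_eq Q.mult_one_right)
  qed
  have "preserves_identities (conv_bundle X) (conv_bundle_comp cmp prd p)
      (\<lambda>x. conv_bundle_comp cmp prd q e x)"
    using X_exch(2) \<open>one p = one q\<close>
    by (auto simp: preserves_identities_def ids conv_bundle_comp_eq_Some_iff e_eq Q.mult_one_left)
  moreover have "preserves_identities (conv_bundle X) (conv_bundle_comp cmp prd p)
      (\<lambda>x. conv_bundle_comp cmp prd q x e)"
    using X_exch(4) \<open>one p = one q\<close>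
    by (auto simp: preserves_identities_def ids conv_bundle_comp_eq_Some_iff e_eq Q.mult_one_right)
  moreover have "preserves_compositions (conv_bundle X) (conv_bundle_comp cmp prd p)
      (\<lambda>x. conv_bundle_comp cmp prd q e x)"
    unfolding preserves_compositions_def using left by blast
  moreover have "preserves_compositions (conv_bundle X) (conv_bundle_comp cmp prd p)
      (\<lambda>x. conv_bundle_comp cmp prd q x e)"
    unfolding preserves_compositions_def using right by blast
  ultimately show "preserves_compositions (conv_bundle X) (conv_bundle_comp cmp prd p)
        (\<lambda>x. conv_bundle_comp cmp prd q e x) \<and>
      preserves_identities (conv_bundle X) (conv_bundle_comp cmp prd p)
        (\<lambda>x. conv_bundle_comp cmp prd q e x) \<and>
      preserves_compositions (conv_bundle X) (conv_bundle_comp cmp prd p)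
        (\<lambda>x. conv_bundle_comp cmp prd q x e) \<and>
      preserves_identities (conv_bundle X) (conv_bundle_comp cmp prd p)
        (\<lambda>x. conv_bundle_comp cmp prd q x e)"
    by blast
qed

lemma n_category_conv_bundle:
  assumes hyper: "hyper_cstar_algebra smul n prd one star"
    and units: "\<And>p q. p < n \<Longrightarrow> q < n \<Longrightarrow> one p = one q"
    and X: "n_category n X cmp"
  shows "n_category n (conv_bundle X) (conv_bundle_comp cmp prd)"
proof -
  interpret X: n_category n X cmp by (rule X)
  note ids = partial_identities_conv_bundle[OF hyper X.one_category]
  show ?thesis
  proof (rule n_category.intro)
    fix p assume "p < n"
    then show "one_category (conv_bundle X) (conv_bundle_comp cmp prd p)"
      by (intro one_category_conv_bundle[OF hyper] X.one_category)
  next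
    fix q p assume "q < p" "p < n"
    then show "partial_identities (conv_bundle X) (conv_bundle_comp cmp prd q)
        \<subseteq> partial_identities (conv_bundle X) (conv_bundle_comp cmp prd p)"
      using X.identities_mono[of q p] units[of q p] by (auto simp: ids)
  next
    fix q p e e' t assume "q < p" "p < n"
      and "e \<in> partial_identities (conv_bundle X) (conv_bundle_comp cmp prd p)"
      and "e' \<in> partial_identities (conv_bundle X) (conv_bundle_comp cmp prd p)"
      and "conv_bundle_comp cmp prd q e e' = Some t"
    moreover obtain nrm where "cstar_algebra smul (prd q) (one q) (star q) nrm"
      using hyper_cstar_algebra_cstarE[OF hyper, of q] \<open>q < p\<close> \<open>p < n\<close> by auto
    then have "prd q (one q) (one q) = one q" by (rule cstar_algebra.mult_one_left)
    ultimately show "t \<in> partial_identities (conv_bundle X) (conv_bundle_comp cmp prd p)"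
      using X.identities_comp[of q p "fst e" "fst e'" "fst t"] units[of p q]
      by (cases t) (auto simp: ids conv_bundle_comp_eq_Some_iff)
  next
    show "usual_exchange n (conv_bundle X) (conv_bundle_comp cmp prd) \<or>
        noncommutative_exchange n (conv_bundle X) (conv_bundle_comp cmp prd)"
      using noncommutative_exchange_conv_bundle[OF hyper units X] by blast
  qed
qed

text \<open>
  An involution \<open>\<dagger>\<^sub>q\<close> sends \<open>\<circ>\<^sub>p\<close>-identities to \<open>\<circ>\<^sub>p\<close>-identities because the common
  unit is the unit of \<open>\<cdot>\<^sub>q\<close> and is therefore fixed by \<open>\<dagger>\<^sub>q\<close>.
\<close>

lemma fully_involutive_conv_bundle:
  fixes X :: "'x set" and prd :: "nat \<Rightarrow> 'a \<Rightarrow> 'a \<Rightarrow> 'a::topological_ab_group_add"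
  assumes hyper: "hyper_cstar_algebra smul n prd one star"
    and compatible: "compatible_pairs n prd one star"
    and X: "fully_involutive_n_category n X cmp dag"
  shows "fully_involutive_n_category n (conv_bundle X)
    (conv_bundle_comp cmp prd) (conv_bundle_inv dag star)"
proof -
  interpret X: fully_involutive_n_category n X cmp dag by (rule X)
  have units: "one p = one q" if "p < n" "q < n" for p q
    using compatible that unfolding compatible_pairs_def by blast
  have star_hom: "star q (prd p a b) = prd p (star q a) (star q b)"
    if "p < n" "q < n" "p \<noteq> q" for p q a b
    using compatible that unfolding compatible_pairs_def by blast
  have star_commute: "star p (star q a) = star q (star p a)" if "p < n" "q < n" for p q a
    using compatible that unfolding compatible_pairs_def by blast
  interpret E: n_category n "conv_bundle X" "conv_bundle_comp cmp prd"
    by (rule n_category_conv_bundle[OF hyper units X.n_category_axioms])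
  note ids = partial_identities_conv_bundle[OF hyper X.one_category]
  have star_star: "star q (star q a) = a" and star_one: "star q (one q) = one q"
    and star_mult: "star q (prd q a b) = prd q (star q b) (star q a)" if "q < n" for q a b
  proof -
    obtain nrm where "cstar_algebra smul (prd q) (one q) (star q) nrm"
      using hyper_cstar_algebra_cstarE[OF hyper \<open>q < n\<close>] .
    then interpret Q: cstar_algebra smul "prd q" "one q" "star q" nrm .
    show "star q (star q a) = a" "star q (one q) = one q"
      "star q (prd q a b) = prd q (star q b) (star q a)"
      by (rule Q.star_star Q.star_one Q.star_mult)+
  qed
  show ?thesis
  proof
    fix q and x :: "'x \<times> 'a" assume "q < n" "x \<in> conv_bundle X"
    then show "conv_bundle_inv dag star q x \<in> conv_bundle X"
      by (simp add: mem_conv_bundle_iff conv_bundle_inv_def X.dag_closed)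
    show "conv_bundle_inv dag star q (conv_bundle_inv dag star q x) = x"
      using \<open>q < n\<close> \<open>x \<in> conv_bundle X\<close>
      by (simp add: mem_conv_bundle_iff conv_bundle_inv_def X.dag_dag star_star)
  next
    fix p q and x y z :: "'x \<times> 'a"
    assume "p < n" "q < n" "p \<noteq> q" "x \<in> conv_bundle X" "y \<in> conv_bundle X"
      "conv_bundle_comp cmp prd p x y = Some z"
    then show "conv_bundle_comp cmp prd p (conv_bundle_inv dag star q x)
        (conv_bundle_inv dag star q y) = Some (conv_bundle_inv dag star q z)"
      using X.dag_comp_neq[of p q "fst x" "fst y" "fst z"]
      by (simp add: mem_conv_bundle_iff conv_bundle_inv_def conv_bundle_comp_eq_Some_iff star_hom)
  next
    fix q and x y z :: "'x \<times> 'a"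
    assume "q < n" "x \<in> conv_bundle X" "y \<in> conv_bundle X"
      "conv_bundle_comp cmp prd q x y = Some z"
    then show "conv_bundle_comp cmp prd q (conv_bundle_inv dag star q y)
        (conv_bundle_inv dag star q x) = Some (conv_bundle_inv dag star q z)"
      using X.dag_comp_eq[of q "fst x" "fst y" "fst z"]
      by (simp add: mem_conv_bundle_iff conv_bundle_inv_def conv_bundle_comp_eq_Some_iff star_mult)
  next
    fix p q e
    assume "p < n" "q < n"
      and "e \<in> partial_identities (conv_bundle X) (conv_bundle_comp cmp prd p)"
    then show "conv_bundle_inv dag star q e
        \<in> partial_identities (conv_bundle X) (conv_bundle_comp cmp prd p)"
      using X.dag_identities[of p q] units[of p q] star_one[of q]
      by (auto simp: ids conv_bundle_inv_def)
  next
    fix p q and x :: "'x \<times> 'a" assume "p < n" "q < n" "x \<in> conv_bundle X"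
    then show "conv_bundle_inv dag star p (conv_bundle_inv dag star q x) =
        conv_bundle_inv dag star q (conv_bundle_inv dag star p x)"
      using X.dag_commute[of p q "fst x"] star_commute[of p q "snd x"]
      by (simp add: mem_conv_bundle_iff conv_bundle_inv_def)
  qed
qed

text \<open>
  A \<open>\<circ>\<^sub>q\<close>-identity \<open>e\<close> is also a \<open>\<circ>\<^sub>p\<close>-identity and composes with itself both ways,
  so its fibre is a copy of \<open>A\<close> with both products on which the usual exchange becomes the
  Eckmann--Hilton law.
\<close>

lemma usual_exchange_conv_bundle_imp_commute:
  assumes hyper: "hyper_cstar_algebra smul n prd one star"
    and units: "\<And>p q. p < n \<Longrightarrow> q < n \<Longrightarrow> one p = one q"
    and X: "n_category n X cmp" and nonempty: "X \<noteq> {}"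
    and usual: "usual_exchange n (conv_bundle X) (conv_bundle_comp cmp prd)"
    and "q < p" "p < n"
  shows "prd p a b = prd p b a" and "prd q a b = prd q b a"
proof -
  interpret X: n_category n X cmp by (rule X)
  have "q < n" using \<open>q < p\<close> \<open>p < n\<close> by simp
  interpret XP: one_category X "cmp p" by (rule X.one_category[OF \<open>p < n\<close>])
  interpret XQ: one_category X "cmp q" by (rule X.one_category[OF \<open>q < n\<close>])
  obtain nrmp where "cstar_algebra smul (prd p) (one p) (star p) nrmp"
    using hyper_cstar_algebra_cstarE[OF hyper \<open>p < n\<close>] .
  then interpret P: cstar_algebra smul "prd p" "one p" "star p" nrmp .
  obtain nrmq where "cstar_algebra smul (prd q) (one q) (star q) nrmq"
    using hyper_cstar_algebra_cstarE[OF hyper \<open>q < n\<close>] .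
  then interpret Q: cstar_algebra smul "prd q" "one q" "star q" nrmq .
  obtain e where e: "e \<in> partial_identities X (cmp q)"
    using nonempty XQ.right_identity by blast
  have eX: "e \<in> X" using e partial_identities_subset by fast
  have ee: "cmp q e e = Some e" "cmp p e e = Some e"
    using e X.identities_mono[OF \<open>q < p\<close> \<open>p < n\<close>]
    by (auto intro: XP.partial_identity_idem XQ.partial_identity_idem)
  have exch: "prd q (prd p a b) (prd p c d) = prd p (prd q a c) (prd q b d)" for a b c d
  proof -
    have "\<exists>r s. conv_bundle_comp cmp prd q (e, a) (e, c) = Some r \<and>
        conv_bundle_comp cmp prd q (e, b) (e, d) = Some s \<and>
        conv_bundle_comp cmp prd p r s = Some (e, prd q (prd p a b) (prd p c d))"
      using usual[unfolded usual_exchange_def, rule_format,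
          of q p "(e, a)" "(e, b)" "(e, c)" "(e, d)" "(e, prd p a b)" "(e, prd p c d)"
          "(e, prd q (prd p a b) (prd p c d))"]
        \<open>q < p\<close> \<open>p < n\<close> eX ee
      by (simp add: mem_conv_bundle_iff conv_bundle_comp_eq_Some_iff)
    then show ?thesis by (auto simp: conv_bundle_comp_eq_Some_iff)
  qed
  have one: "one p = one q" using units \<open>p < n\<close> \<open>q < n\<close> by blast
  note commute = Eckmann_Hilton_commute[of "prd q" "prd p" "one q", OF exch
      P.mult_one_left[unfolded one] P.mult_one_right[unfolded one]
      Q.mult_one_left Q.mult_one_right]
  show "prd p a b = prd p b a" "prd q a b = prd q b a" by (rule commute)+
qed

theorem theorem5p37:
  fixes n :: nat
    and smul :: "complex \<Rightarrow> 'a::topological_ab_group_add \<Rightarrow> 'a"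
    and prd :: "nat \<Rightarrow> 'a \<Rightarrow> 'a \<Rightarrow> 'a"
    and one :: "nat \<Rightarrow> 'a"
    and star :: "nat \<Rightarrow> 'a \<Rightarrow> 'a"
    and X :: "'x set"
    and cmp :: "nat \<Rightarrow> 'x \<Rightarrow> 'x \<Rightarrow> 'x option"
    and dag :: "nat \<Rightarrow> 'x \<Rightarrow> 'x"
  assumes hyper: "hyper_cstar_algebra smul n prd one star"
    and compatible: "compatible_pairs n prd one star"
    and category: "fully_involutive_n_category n X cmp dag"
  shows "fully_involutive_n_category n (conv_bundle X) (conv_bundle_comp cmp prd) (conv_bundle_inv dag star)
    \<and> noncommutative_exchange n (conv_bundle X) (conv_bundle_comp cmp prd)
    \<and> (X \<noteq> {} \<and> n \<ge> 2 \<and> (\<exists>k<n. \<exists>a b. prd k a b \<noteq> prd k b a) \<longrightarrow>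
        \<not> usual_exchange n (conv_bundle X) (conv_bundle_comp cmp prd))"
proof -
  have units: "one p = one q" if "p < n" "q < n" for p q
    using compatible that unfolding compatible_pairs_def by blast
  interpret X: fully_involutive_n_category n X cmp dag by (rule category)
  note X = X.n_category_axioms
  have "\<not> usual_exchange n (conv_bundle X) (conv_bundle_comp cmp prd)"
    if "X \<noteq> {}" "n \<ge> 2" "k < n" "prd k a b \<noteq> prd k b a" for k a b
  proof
    assume usual: "usual_exchange n (conv_bundle X) (conv_bundle_comp cmp prd)"
    note commute = usual_exchange_conv_bundle_imp_commute
        [OF hyper units X \<open>X \<noteq> {}\<close> usual]
    \<comment> \<open>The product \<open>k\<close> needs a partner: a lower one if \<open>k > 0\<close>, and a higher one, which
      exists because \<open>n \<ge> 2\<close>, if \<open>k = 0\<close>.\<close>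
    show False
    proof (cases "k = 0")
      case True
      then show False using commute(2)[of 0 1 a b] that by simp
    next
      case False
      then show False using commute(1)[of 0 k a b] that by simp
    qed
  qed
  then show ?thesis
    using fully_involutive_conv_bundle[OF hyper compatible category]
      noncommutative_exchange_conv_bundle[OF hyper units X] by blast
qed

end
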